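(* Let $(G,\mathcal{F})$ be a Gaussian sheaf with stalk dimension $d$ and restriction maps in $O(d)$ over a finite connected undirected graph $G=(V,E)$, let $v\in V$, and let $\vartheta\in\mathcal{G}(\mathbb{R}^d)$. Then there exists $\nu\in H^0(G,\mathcal{F})$ with $\nu_v=\vartheta$ if and only if for every cycle $\gamma$ based at $v$ it holds that $\mathbf{P}^{\gamma}_{v\to v}\in\operatorname{Stab}(\vartheta)$.
   Context: $\mathcal{G}(\mathbb{R}^d)$ is the set of (possibly degenerate) Gaussian distributions $\mathcal{N}(\mu,\Sigma)$ on $\mathbb{R}^d$, identified with pairs $(\mu,\Sigma)$, $\mu\in\mathbb{R}^d$, $\Sigma$ symmetric positive semidefinite. For $A\in\mathbb{R}^{d\times d}$ put $\Phi_A(\mu,\Sigma)=(A\mu,A\Sigma A^\top)$, so $\Phi_B\circ\Phi_A=\Phi_{BA}$. A Gaussian sheaf $(G,\mathcal{F})$ with stalk dimension $d$ assigns the stalk $\mathcal{G}(\mathbb{R}^d)$ to each vertex and each edge, and to each incident vertex–edge pair $v\unlhd e$ a matrix $\mathcal{F}_{v\unlhd e}\in\mathbb{R}^{d\times d}$, acting as the restriction map $\Phi_{\mathcal{F}_{v\unlhd e}}$ from the stalk at $v$ to the stalk at $e$. "Restriction maps in $O(d)$" means all $\mathcal{F}_{v\unlhd e}$ are orthogonal matrices. $C^0(G,\mathcal{F})$ is the set of families $\nu=(\nu_v)_{v\in V}$ with $\nu_v\in\mathcal{G}(\mathbb{R}^d)$, and $H^0(G,\mathcal{F})$ is the set of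 global sections: those $\nu$ with $\Phi_{\mathcal{F}_{v\unlhd e}}(\nu_v)=\Phi_{\mathcal{F}_{u\unlhd e}}(\nu_u)$ for every edge $e$ with endpoints $v,u$. A path $\gamma=(w_0,w_1,\dots,w_m)$ is a sequence of vertices with consecutive vertices joined by edges $e_i=(w_i,w_{i+1})$ (repetitions allowed); a cycle based at $v$ is a path with $w_0=w_m=v$. The transport along $\gamma$ is $\mathbf{P}^\gamma_{w_0\to w_m}=\Phi_{\mathcal{F}_{w_m\unlhd e_{m-1}}^\top}\circ\Phi_{\mathcal{F}_{w_{m-1}\unlhd e_{m-1}}}\circ\cdots\circ\Phi_{\mathcal{F}_{w_1\unlhd e_0}^\top}\circ\Phi_{\mathcal{F}_{w_0\unlhd e_0}}$. $\mathbf{P}^\gamma_{v\to v}\in\operatorname{Stab}(\vartheta)$ means $\mathbf{P}^\gamma_{v\to v}(\vartheta)=\vartheta$. *)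

theory Defs
  imports "HOL-Analysis.Analysis"
begin

section \<open>Gaussian distributions\<close>

definition pos_semidef :: "real^'n^'n \<Rightarrow> bool" where
  "pos_semidef S \<longleftrightarrow> transpose S = S \<and> (\<forall>x. 0 \<le> x \<bullet> (S *v x))"

text \<open>A possibly degenerate Gaussian distribution is identified with its pair of mean and
  covariance matrix; \<open>CARD('n)\<close> is the dimension of the underlying space.\<close>

type_synonym 'n mean_cov = "(real^'n) \<times> (real^'n^'n)"

definition gaussians :: "'n::finite mean_cov set" where
  "gaussians = {(\<mu>, S). pos_semidef S}"

definition Phi :: "real^'n^'n \<Rightarrow> 'n::finite mean_cov \<Rightarrow> 'n mean_cov" where
  "Phi A = (\<lambda>(\<mu>, S). (A *v \<mu>, A ** S ** transpose A))"

definition Stab :: "'n::finite mean_cov \<Rightarrow> ('n mean_cov \<Rightarrow> 'n mean_cov) set" where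
  "Stab \<theta> = {P. P \<theta> = \<theta>}"

lemma Phi_compose: "Phi B \<circ> Phi A = Phi (B ** A)"
  by (auto simp: Phi_def fun_eq_iff matrix_vector_mul_assoc matrix_transpose_mul matrix_mul_assoc)

lemma Phi_in_gaussians:
  assumes "\<theta> \<in> gaussians"
  shows "Phi A \<theta> \<in> gaussians"
proof -
  obtain \<mu> S where \<theta>: "\<theta> = (\<mu>, S)" and S: "transpose S = S" "\<And>x. 0 \<le> x \<bullet> (S *v x)"
    using assms by (auto simp: gaussians_def pos_semidef_def)
  have "0 \<le> x \<bullet> ((A ** S ** transpose A) *v x)" for x
    using S(2)[of "transpose A *v x"]
    by (simp add: matrix_vector_mul_assoc[symmetric] dot_lmul_matrix[symmetric])
  then show ?thesis
    by (simp add: \<theta> gaussians_def Phi_def pos_semidef_def matrix_transpose_mul S(1) matrix_mul_assoc)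
qed


section \<open>Graphs and paths\<close>

definition fin_graph :: "'v set \<Rightarrow> 'v set set \<Rightarrow> bool" where
  "fin_graph V E \<longleftrightarrow> finite V \<and> (\<forall>e\<in>E. e \<subseteq> V \<and> card e = 2)"

definition path_in :: "'v set \<Rightarrow> 'v set set \<Rightarrow> 'v list \<Rightarrow> bool" where
  "path_in V E ws \<longleftrightarrow> ws \<noteq> [] \<and> set ws \<subseteq> V \<and> successively (\<lambda>u w. {u, w} \<in> E) ws"

definition cycle_at :: "'v set \<Rightarrow> 'v set set \<Rightarrow> 'v \<Rightarrow> 'v list \<Rightarrow> bool" where
  "cycle_at V E v ws \<longleftrightarrow> path_in V E ws \<and> hd ws = v \<and> last ws = v"

definition connected_graph :: "'v set \<Rightarrow> 'v set set \<Rightarrow> bool" where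
  "connected_graph V E \<longleftrightarrow>
    V \<noteq> {} \<and> (\<forall>u\<in>V. \<forall>w\<in>V. \<exists>ws. path_in V E ws \<and> hd ws = u \<and> last ws = w)"


section \<open>Gaussian sheaves\<close>

text \<open>All stalks are \<open>gaussians\<close>, so a Gaussian sheaf on a graph is given by its matrices alone:
  \<open>F v e\<close> is the matrix of the restriction map from \<open>v\<close> to \<open>e\<close>. Its value is
  only meaningful for \<open>v \<in> e\<close> and \<open>e \<in> E\<close>.\<close>

type_synonym ('v, 'n) gaussian_sheaf = "'v \<Rightarrow> 'v set \<Rightarrow> real^'n^'n"

definition orthogonal_sheaf :: "'v set set \<Rightarrow> ('v, 'n::finite) gaussian_sheaf \<Rightarrow> bool" where
  "orthogonal_sheaf E F \<longleftrightarrow> (\<forall>e\<in>E. \<forall>v\<in>e. orthogonal_matrix (F v e))"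

definition C0 :: "'v set \<Rightarrow> ('v \<Rightarrow> 'n::finite mean_cov) set" where
  "C0 V = (\<Pi>\<^sub>E v\<in>V. gaussians)"

definition H0 ::
  "'v set \<Rightarrow> 'v set set \<Rightarrow> ('v, 'n::finite) gaussian_sheaf \<Rightarrow> ('v \<Rightarrow> 'n mean_cov) set" where
  "H0 V E F = {\<nu> \<in> C0 V. \<forall>e\<in>E. \<forall>v\<in>e. \<forall>u\<in>e. Phi (F v e) (\<nu> v) = Phi (F u e) (\<nu> u)}"

fun transport :: "('v, 'n::finite) gaussian_sheaf \<Rightarrow> 'v list \<Rightarrow> 'n mean_cov \<Rightarrow> 'n mean_cov" where
  "transport F (u # w # ws) =
    transport F (w # ws) \<circ> Phi (transpose (F w {u, w})) \<circ> Phi (F u {u, w})"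
| "transport F _ = id"

end

theory Submission
  imports Defs
begin

text \<open>Transport is functorial under concatenation of paths and, the restriction maps being
  orthogonal, transport along the reversed path is the inverse. If all cycles at \<open>v\<close>
  stabilise \<open>\<theta>\<close>, the transport of \<open>\<theta>\<close> from \<open>v\<close> to a vertex therefore does not depend on
  the path, and transporting \<open>\<theta>\<close> everywhere gives a global section. Conversely, a global section
  is carried to itself by transport.\<close>

lemma Phi_mat_1 [simp]: "Phi (mat 1) = id"
  by (auto simp: Phi_def fun_eq_iff transpose_mat)

lemma Phi_orthogonal_inverse:
  assumes "orthogonal_matrix A"
  shows "Phi (transpose A) (Phi A \<theta>) = \<theta>" and "Phi A (Phi (transpose A) \<theta>) = \<theta>"
  using assms Phi_compose[of "transpose A" A] Phi_compose[of A "transpose A"]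
  by (auto simp: orthogonal_matrix_def dest: fun_cong[of _ _ \<theta>])

lemma path_in_Cons_Cons:
  "path_in V E (u # w # ws) \<longleftrightarrow> u \<in> V \<and> {u, w} \<in> E \<and> path_in V E (w # ws)"
  by (auto simp: path_in_def)

lemma path_in_singleton [simp]: "path_in V E [u] \<longleftrightarrow> u \<in> V"
  by (simp add: path_in_def)

text \<open>The vertex where the paths meet must be listed only once, since repeating it would
  demand a loop as an edge; hence \<open>tl ys\<close>.\<close>

lemma path_in_concat:
  assumes "path_in V E xs" "path_in V E ys" "last xs = hd ys"
  shows "path_in V E (xs @ tl ys)"
    and "hd (xs @ tl ys) = hd xs"
    and "last (xs @ tl ys) = last ys"
  using assms
  by (cases ys; cases "tl ys"; auto simp: path_in_def successively_append_iff)+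

lemma path_in_rev:
  assumes "path_in V E xs"
  shows "path_in V E (rev xs)"
  using assms by (simp add: path_in_def insert_commute)

lemma transport_concat:
  assumes "xs \<noteq> []" "ys \<noteq> []" "last xs = hd ys"
  shows "transport F (xs @ tl ys) = transport F ys \<circ> transport F xs"
  using assms
proof (induction xs rule: induct_list012)
  \<comment> \<open>Here \<open>x = hd ys\<close>, so \<open>[x] @ tl ys\<close> is
    \<open>ys\<close> itself, and transport along \<open>[x]\<close> is the identity.\<close>
  case (2 x)
  then show ?case by (cases ys) auto
next
  case (3 u w ws)
  then show ?case by (simp add: o_assoc)
qed simp

text \<open>The reversed path crosses the first edge last, in the opposite direction, and so cancels
  it by orthogonality. The induction hypothesis is needed at the image of \<theta> under that edge,
  so \<theta> is kept arbitrary.\<close>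

lemma transport_rev:
  assumes "orthogonal_sheaf E F" "path_in V E xs"
  shows "transport F (rev xs) (transport F xs \<theta>) = \<theta>"
  using assms(2)
proof (induction xs arbitrary: \<theta> rule: induct_list012)
  case (3 u w ws)
  then have uw: "{u, w} \<in> E" "path_in V E (w # ws)"
    by (simp_all add: path_in_Cons_Cons)
  have orth: "orthogonal_matrix (F u {u, w})" "orthogonal_matrix (F w {u, w})"
    using assms(1) uw(1) by (auto simp: orthogonal_sheaf_def)
  have "transport F (rev (u # w # ws)) = transport F [w, u] \<circ> transport F (rev (w # ws))"
    using transport_concat[of "rev (w # ws)" "[w, u]" F] by simp
  \<comment> \<open>\<open>transport\<close> writes each edge in the order of traversal; both
    directions must refer to the same matrices.\<close>
  moreover have "{w, u} = {u, w}" by blast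
  ultimately show ?case
    using "3.IH"(2)[OF uw(2)] orth by (simp add: Phi_orthogonal_inverse)
qed auto

lemma transport_in_gaussians:
  assumes "\<theta> \<in> gaussians"
  shows "transport F xs \<theta> \<in> gaussians"
  using assms
  by (induction xs arbitrary: \<theta> rule: induct_list012) (simp_all add: Phi_in_gaussians)

text \<open>Across an edge, the section condition replaces the restriction from \<open>u\<close> by
  the one from \<open>w\<close>, which the transposed matrix then undoes.\<close>

lemma transport_global_section:
  assumes "orthogonal_sheaf E F" "\<nu> \<in> H0 V E F" "path_in V E xs"
  shows "transport F xs (\<nu> (hd xs)) = \<nu> (last xs)"
  using assms(3)
proof (induction xs rule: induct_list012)
  case (3 u w ws)
  then have uw: "{u, w} \<in> E" "path_in V E (w # ws)"
    by (simp_all add: path_in_Cons_Cons)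
  have "orthogonal_matrix (F w {u, w})"
    using assms(1) uw(1) by (auto simp: orthogonal_sheaf_def)
  moreover have "Phi (F u {u, w}) (\<nu> u) = Phi (F w {u, w}) (\<nu> w)"
    using assms(2) uw(1) by (auto simp: H0_def)
  ultimately show ?case
    using "3.IH"(2)[OF uw(2)] by (simp add: Phi_orthogonal_inverse)
qed (auto simp: path_in_def)

lemma transport_path_independent:
  assumes orth: "orthogonal_sheaf E F"
    and stab: "\<And>\<gamma>. cycle_at V E v \<gamma> \<Longrightarrow> transport F \<gamma> \<in> Stab \<theta>"
    and xs: "path_in V E xs" "hd xs = v"
    and ys: "path_in V E ys" "hd ys = v"
    and "last xs = last ys"
  shows "transport F xs \<theta> = transport F ys \<theta>"
proof -
  have ne: "xs \<noteq> []" "ys \<noteq> []"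
    using xs ys by (auto simp: path_in_def)
  have meet: "last xs = hd (rev ys)"
    using \<open>last xs = last ys\<close> by (simp add: hd_rev)
  \<comment> \<open>Out along \<open>xs\<close> and back along \<open>ys\<close>.\<close>
  have "cycle_at V E v (xs @ tl (rev ys))"
    using path_in_concat[OF xs(1) path_in_rev[OF ys(1)] meet] xs ys
    by (simp add: cycle_at_def last_rev)
  then have "transport F (rev ys) (transport F xs \<theta>) = \<theta>"
    using stab transport_concat[of xs "rev ys" F] ne meet by (force simp: Stab_def)
  moreover have "transport F ys (transport F (rev ys) (transport F xs \<theta>)) = transport F xs \<theta>"
    using transport_rev[OF orth path_in_rev[OF ys(1)]] by simp
  ultimately show ?thesis by simp
qed

lemma global_section_of_stabilised:
  assumes graph: "fin_graph V E" "connected_graph V E"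
    and orth: "orthogonal_sheaf E F"
    and "v \<in> V" "\<theta> \<in> gaussians"
    and stab: "\<And>\<gamma>. cycle_at V E v \<gamma> \<Longrightarrow> transport F \<gamma> \<in> Stab \<theta>"
  shows "\<exists>\<nu> \<in> H0 V E F. \<nu> v = \<theta>"
proof -
  have "\<forall>u\<in>V. \<exists>ws. path_in V E ws \<and> hd ws = v \<and> last ws = u"
    using graph(2) \<open>v \<in> V\<close> by (auto simp: connected_graph_def)
  then obtain p where p: "\<And>u. u \<in> V \<Longrightarrow> path_in V E (p u) \<and> hd (p u) = v \<and> last (p u) = u"
    by metis
  \<comment> \<open>\<open>restrict\<close> is there because \<open>C0\<close> consists of
    extensional functions.\<close>
  define \<nu> where "\<nu> = restrict (\<lambda>u. transport F (p u) \<theta>) V"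
  \<comment> \<open>By path independence any path from \<open>v\<close> computes \<nu>, so the
    choice of \<open>p\<close> can be forgotten.\<close>
  have \<nu>_eq: "\<nu> (last xs) = transport F xs \<theta>"
    if "path_in V E xs" "hd xs = v" for xs
  proof -
    have "last xs \<in> V"
      using that(1) by (auto simp: path_in_def)
    moreover from this have "transport F (p (last xs)) \<theta> = transport F xs \<theta>"
      using p that by (intro transport_path_independent[OF orth stab]) auto
    ultimately show ?thesis
      by (simp add: \<nu>_def)
  qed
  have "Phi (F a e) (\<nu> a) = Phi (F b e) (\<nu> b)" if "e \<in> E" "a \<in> e" "b \<in> e" for a b e
  proof (cases "a = b")
    case False
    have "card e = 2" "e \<subseteq> V"
      using graph(1) that(1) by (auto simp: fin_graph_def)
    then have e: "e = {a, b}" and ab: "a \<in> V" "b \<in> V"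
      using that False by (auto simp: card_2_iff)
    have pa: "path_in V E (p a)" "hd (p a) = v" "last (p a) = a"
      using p[OF ab(1)] by auto
    have edge: "path_in V E [a, b]"
      using that(1) ab e by (simp add: path_in_Cons_Cons)
    note ext = path_in_concat[OF pa(1) edge]
    \<comment> \<open>The path to \<open>b\<close> is chosen to run through \<open>a\<close> and end
      with the edge \<open>e\<close>, which expresses \<open>\<nu> b\<close> through
      \<open>\<nu> a\<close>.\<close>
    have "\<nu> b = transport F (p a @ tl [a, b]) \<theta>"
      using \<nu>_eq[of "p a @ tl [a, b]"] ext pa by simp
    also have "\<dots> = transport F [a, b] (transport F (p a) \<theta>)"
      using pa transport_concat[of "p a" "[a, b]" F] by (auto simp: path_in_def)
    also have "\<dots> = Phi (transpose (F b e)) (Phi (F a e) (\<nu> a))"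
      using \<nu>_eq[OF pa(1,2)] pa(3) e by simp
    finally show ?thesis
      using orth that by (simp add: orthogonal_sheaf_def Phi_orthogonal_inverse)
  qed simp
  moreover have "\<nu> \<in> C0 V"
    using \<open>\<theta> \<in> gaussians\<close> by (auto simp: C0_def \<nu>_def transport_in_gaussians)
  \<comment> \<open>\<open>p v\<close> may be a nontrivial cycle; the path \<open>[v]\<close> has
    identity transport.\<close>
  moreover have "\<nu> v = \<theta>"
    using \<nu>_eq[of "[v]"] \<open>v \<in> V\<close> by simp
  ultimately show ?thesis
    unfolding H0_def by blast
qed

theorem proposition4p3:
  fixes V :: "'v set" and E :: "'v set set"
    and F :: "('v, 'n::finite) gaussian_sheaf"
    and v :: 'v and \<theta> :: "'n mean_cov"
  assumes "fin_graph V E" and "connected_graph V E"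
    and "orthogonal_sheaf E F"
    and "v \<in> V" and "\<theta> \<in> gaussians"
  shows "(\<exists>\<nu> \<in> H0 V E F. \<nu> v = \<theta>) \<longleftrightarrow>
    (\<forall>\<gamma>. cycle_at V E v \<gamma> \<longrightarrow> transport F \<gamma> \<in> Stab \<theta>)"
proof
  assume "\<exists>\<nu> \<in> H0 V E F. \<nu> v = \<theta>"
  then show "\<forall>\<gamma>. cycle_at V E v \<gamma> \<longrightarrow> transport F \<gamma> \<in> Stab \<theta>"
    using transport_global_section[OF assms(3)] by (fastforce simp: cycle_at_def Stab_def)
next
  assume "\<forall>\<gamma>. cycle_at V E v \<gamma> \<longrightarrow> transport F \<gamma> \<in> Stab \<theta>"
  then show "\<exists>\<nu> \<in> H0 V E F. \<nu> v = \<theta>"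
    using global_section_of_stabilised[OF assms] by blast
qed

end
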